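(* Let $G$ be a graph and let $e$ be an edge of $G$ that is neither a loop nor an isthmus. Then $$FH_G(\mathbf x)=FH_{G\setminus e}(\mathbf x')+(1-2x_e)\,FH_{G/e}(\mathbf x'),$$ where $\mathbf x'$ is obtained from $\mathbf x$ by deleting the entry $x_e$ corresponding to the edge $e$.
   Context: Graphs are finite and may have loops and multiple edges. $G\setminus e$ is the graph obtained by deleting the edge $e$; $G/e$ is the graph obtained by contracting $e$ (identifying its endpoints into a single vertex and deleting $e$). An isthmus is an edge whose deletion increases the number of connected components; a loop is an edge connecting a vertex to itself. Let $G$ be a graph with edge set $E$, $n=|E|$, coordinates of $\mathbb F_2^n$ being indexed by $E$. $\mathcal T_G$ is the set of spanning trees of $G$; for $T\in\mathcal T_G$, $\mathbf v_T\in\mathbb F_2^n$ is the characteristic vector of its edge set. $f_G:\mathbb F_2^n\to\mathbb F_2$ is the Boolean function with support $\{\mathbf v_T:T\in\mathcal T_G\}$. Its Fourier-Hadamard transform is $\widehat f_G(\mathbf u)=\sum_{T\in\mathcal T_G}(-1)^{\mathbf v_T\cdot\mathbf u}\in\mathbb Z$, with $\mathbf x\cdot\mathbf u$ the usual inner product mod 2. The $FH_G$-polynomial $FH_G(\mathbf x)$ is the Numerical Normal Form of $\widehat f_G$, i.e. its representative in $\mathbb R[x_i:i\in E]/(x_i^2-x_i:i\in E)$ (coordinates in $\mathbb F_2$ being read as real numbers $0,1$); thus $FH_G(\mathbf x)=\widehat f_G(\mathbf x)$. *)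

theory Defs
  imports Complex_Main "HOL-Library.FuncSet" "HOL-Library.Uprod" "HOL-Library.Z2"
    "HOL-Library.Poly_Mapping"
begin

text \<open>An edge \<open>e\<close> with \<open>ends G e = Upair u v\<close> joins \<open>u\<close> and \<open>v\<close>; it is a loop if \<open>u = v\<close>.
  The values of \<open>ends G\<close> outside \<open>edges G\<close> are irrelevant.\<close>

record ('v, 'e) mgraph =
  verts :: "'v set"
  edges :: "'e set"
  ends :: "'e \<Rightarrow> 'v uprod"

definition multigraph :: "('v, 'e) mgraph \<Rightarrow> bool" where
  "multigraph G \<longleftrightarrow> finite (verts G) \<and> finite (edges G) \<and>
     (\<forall>e\<in>edges G. set_uprod (ends G e) \<subseteq> verts G)"

definition is_loop :: "('v, 'e) mgraph \<Rightarrow> 'e \<Rightarrow> bool" where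
  "is_loop G e \<longleftrightarrow> (\<exists>v. ends G e = Upair v v)"

definition adj :: "('v, 'e) mgraph \<Rightarrow> ('v \<times> 'v) set" where
  "adj G = {(u, v). \<exists>e\<in>edges G. ends G e = Upair u v}"

definition reachable :: "('v, 'e) mgraph \<Rightarrow> ('v \<times> 'v) set" where
  "reachable G = {(u, v). u \<in> verts G \<and> v \<in> verts G \<and> (u, v) \<in> (adj G)\<^sup>*}"

definition components :: "('v, 'e) mgraph \<Rightarrow> 'v set set" where
  "components G = verts G // reachable G"

definition connected_graph :: "('v, 'e) mgraph \<Rightarrow> bool" where
  "connected_graph G \<longleftrightarrow> verts G \<noteq> {} \<and> (\<forall>u\<in>verts G. \<forall>v\<in>verts G. (u, v) \<in> reachable G)"

text \<open>A cycle visits the distinct vertices \<open>vs ! 0, vs ! 1, \<dots>\<close> in cyclic order along the distinct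
  edges \<open>es ! 0, es ! 1, \<dots>\<close>. A loop is a cycle of length 1, two parallel edges form a cycle of
  length 2.\<close>

definition is_cycle :: "('v, 'e) mgraph \<Rightarrow> 'v list \<Rightarrow> 'e list \<Rightarrow> bool" where
  "is_cycle G vs es \<longleftrightarrow> es \<noteq> [] \<and> length vs = length es \<and> distinct vs \<and> distinct es \<and>
     set es \<subseteq> edges G \<and>
     (\<forall>i<length es. ends G (es ! i) = Upair (vs ! i) (vs ! (Suc i mod length es)))"

definition is_tree :: "('v, 'e) mgraph \<Rightarrow> bool" where
  "is_tree G \<longleftrightarrow> connected_graph G \<and> \<not> (\<exists>vs es. is_cycle G vs es)"

text \<open>A spanning tree contains all vertices of the graph, so it is identified with its edge set.\<close>

definition spanning_trees :: "('v, 'e) mgraph \<Rightarrow> 'e set set" where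
  "spanning_trees G = {T. T \<subseteq> edges G \<and> is_tree (G\<lparr>edges := T\<rparr>)}"

definition delete_edge :: "('v, 'e) mgraph \<Rightarrow> 'e \<Rightarrow> ('v, 'e) mgraph" where
  "delete_edge G e = G\<lparr>edges := edges G - {e}\<rparr>"

text \<open>The vertices of the contraction are the classes of the relation on the vertices of \<open>G\<close> that
  identifies the endpoints of \<open>e\<close>: the set of these endpoints and the remaining singletons.
  Other edges joining the endpoints of \<open>e\<close> become loops.\<close>

definition merge_ends :: "('v, 'e) mgraph \<Rightarrow> 'e \<Rightarrow> 'v \<Rightarrow> 'v set" where
  "merge_ends G e v = (if v \<in> set_uprod (ends G e) then set_uprod (ends G e) else {v})"

definition contract_edge :: "('v, 'e) mgraph \<Rightarrow> 'e \<Rightarrow> ('v set, 'e) mgraph" where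
  "contract_edge G e =
     \<lparr>verts = merge_ends G e ` verts G,
      edges = edges G - {e},
      ends = (\<lambda>f. map_uprod (merge_ends G e) (ends G f))\<rparr>"

definition isthmus :: "('v, 'e) mgraph \<Rightarrow> 'e \<Rightarrow> bool" where
  "isthmus G e \<longleftrightarrow> e \<in> edges G \<and> card (components (delete_edge G e)) > card (components G)"

text \<open>Vectors are extensional, i.e. \<open>undefined\<close> outside \<open>E\<close>, so that \<open>F2 E\<close> has \<open>2 ^ card E\<close>
  elements.\<close>

definition F2 :: "'e set \<Rightarrow> ('e \<Rightarrow> bit) set" where
  "F2 E = E \<rightarrow>\<^sub>E UNIV"

definition lift_bit :: "bit \<Rightarrow> 'a::zero_neq_one" where
  "lift_bit b = (if b = 1 then 1 else 0)"

definition dot :: "'e set \<Rightarrow> ('e \<Rightarrow> bit) \<Rightarrow> ('e \<Rightarrow> bit) \<Rightarrow> bit" where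
  "dot E x u = (\<Sum>i\<in>E. x i * u i)"

definition char_vec :: "'e set \<Rightarrow> 'e set \<Rightarrow> 'e \<Rightarrow> bit" where
  "char_vec E T = (\<lambda>i\<in>E. if i \<in> T then 1 else 0)"

definition fourier_hadamard :: "'e set \<Rightarrow> (('e \<Rightarrow> bit) \<Rightarrow> bit) \<Rightarrow> ('e \<Rightarrow> bit) \<Rightarrow> int" where
  "fourier_hadamard E f u = (\<Sum>x\<in>F2 E. lift_bit (f x) * (-1) ^ lift_bit (dot E x u))"

definition tree_function :: "('v, 'e) mgraph \<Rightarrow> ('e \<Rightarrow> bit) \<Rightarrow> bit" where
  "tree_function G x = (if x \<in> char_vec (edges G) ` spanning_trees G then 1 else 0)"

text \<open>Polynomials in variables indexed by \<open>'e\<close>: finitely supported maps from monomials (exponent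
  vectors) to coefficients.\<close>

type_synonym 'e rpoly = "('e \<Rightarrow>\<^sub>0 nat) \<Rightarrow>\<^sub>0 real"

definition Var :: "'e \<Rightarrow> 'e rpoly" where
  "Var i = Poly_Mapping.single (Poly_Mapping.single i 1) 1"

definition poly_eval :: "'e rpoly \<Rightarrow> ('e \<Rightarrow> real) \<Rightarrow> real" where
  "poly_eval p x = (\<Sum>m\<in>Poly_Mapping.keys p.
     Poly_Mapping.lookup p m * (\<Prod>i\<in>Poly_Mapping.keys m. x i ^ Poly_Mapping.lookup m i))"

definition poly_vars :: "'e rpoly \<Rightarrow> 'e set" where
  "poly_vars p = \<Union> (Poly_Mapping.keys ` Poly_Mapping.keys p)"

definition multilinear :: "'e rpoly \<Rightarrow> bool" where
  "multilinear p \<longleftrightarrow> (\<forall>m\<in>Poly_Mapping.keys p. \<forall>i. Poly_Mapping.lookup m i \<le> 1)"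

definition is_nnf :: "'e set \<Rightarrow> (('e \<Rightarrow> bit) \<Rightarrow> real) \<Rightarrow> 'e rpoly \<Rightarrow> bool" where
  "is_nnf E g p \<longleftrightarrow> multilinear p \<and> poly_vars p \<subseteq> E \<and>
     (\<forall>x\<in>F2 E. poly_eval p (\<lambda>i. lift_bit (x i)) = g x)"

text \<open>A class of real polynomials in the variables from \<open>E\<close> modulo the ideal generated by the
  polynomials \<open>Var i ^ 2 - Var i\<close> is represented by its unique multilinear element. Existence and
  uniqueness of the Numerical Normal Form for finite \<open>E\<close> are proved in \<open>ex1_nnf\<close> below.\<close>

definition nnf :: "'e set \<Rightarrow> (('e \<Rightarrow> bit) \<Rightarrow> real) \<Rightarrow> 'e rpoly" where
  "nnf E g = (THE p. is_nnf E g p)"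

definition FH :: "('v, 'e) mgraph \<Rightarrow> 'e rpoly" where
  "FH G = nnf (edges G) (\<lambda>u. of_int (fourier_hadamard (edges G) (tree_function G) u))"

lemma finite_F2: "finite E \<Longrightarrow> finite (F2 E)"
proof -
  have "(UNIV :: bit set) = {0, 1}"
    by (auto intro: bit.exhaust)
  then have "finite (UNIV :: bit set)"
    by (metis finite.emptyI finite.insertI)
  then show "finite E \<Longrightarrow> finite (F2 E)"
    unfolding F2_def by (intro finite_PiE) auto
qed

lemma char_vec_in_F2: "char_vec E T \<in> F2 E"
  by (simp add: char_vec_def F2_def)

lemma fourier_hadamard_tree_function:
  assumes "finite (edges G)"
  shows "fourier_hadamard (edges G) (tree_function G) u =
    (\<Sum>T\<in>spanning_trees G. (-1) ^ lift_bit (dot (edges G) (char_vec (edges G) T) u))"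
proof -
  let ?E = "edges G" and ?C = "char_vec (edges G)" and ?S = "spanning_trees G"
  have inj: "inj_on ?C ?S"
  proof (rule inj_onI)
    fix S T assume "S \<in> ?S" "T \<in> ?S" and eq: "?C S = ?C T"
    then have sub: "S \<subseteq> ?E" "T \<subseteq> ?E" by (auto simp: spanning_trees_def)
    have "i \<in> S \<longleftrightarrow> i \<in> T" if "i \<in> ?E" for i
      using fun_cong[OF eq, of i] that by (auto simp: char_vec_def split: if_splits)
    then show "S = T" using sub by blast
  qed
  have "fourier_hadamard ?E (tree_function G) u =
      (\<Sum>x\<in>F2 ?E. if x \<in> ?C ` ?S then (-1) ^ lift_bit (dot ?E x u) else 0)"
    unfolding fourier_hadamard_def
    by (rule sum.cong) (auto simp: tree_function_def lift_bit_def)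
  also have "\<dots> = (\<Sum>x\<in>F2 ?E \<inter> ?C ` ?S. (-1) ^ lift_bit (dot ?E x u))"
    by (rule sum.inter_restrict[symmetric]) (simp add: finite_F2 assms)
  also have "F2 ?E \<inter> ?C ` ?S = ?C ` ?S"
    using char_vec_in_F2 by blast
  finally show ?thesis
    by (simp add: sum.reindex[OF inj])
qed

lemma poly_eval_superset:
  assumes "finite A" "Poly_Mapping.keys p \<subseteq> A"
  shows "poly_eval p x = (\<Sum>m\<in>A.
     Poly_Mapping.lookup p m * (\<Prod>i\<in>Poly_Mapping.keys m. x i ^ Poly_Mapping.lookup m i))"
  unfolding poly_eval_def using assms
  by (intro sum.mono_neutral_left) (auto simp: in_keys_iff)

lemma poly_eval_diff: "poly_eval (p - q) x = poly_eval p x - poly_eval q x"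
proof -
  let ?A = "Poly_Mapping.keys p \<union> Poly_Mapping.keys q"
  have "Poly_Mapping.keys (p - q) \<subseteq> ?A" by (rule keys_diff)
  then show ?thesis
    by (simp add: poly_eval_superset[of ?A] lookup_minus sum_subtractf algebra_simps)
qed

lemma nnf_zero:
  assumes "is_nnf E (\<lambda>_. 0) p"
  shows "p = 0"
proof (rule ccontr)
  assume "p \<noteq> 0"
  then have "Poly_Mapping.keys p \<noteq> {}" by simp
  then obtain m where m: "m \<in> Poly_Mapping.keys p"
    and min: "\<And>m'. m' \<in> Poly_Mapping.keys p \<Longrightarrow>
      card (Poly_Mapping.keys m) \<le> card (Poly_Mapping.keys m')"
    using ex_has_least_nat[of "\<lambda>m. m \<in> Poly_Mapping.keys p" _ "\<lambda>m. card (Poly_Mapping.keys m)"]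
    by (metis ex_in_conv)
  let ?x = "char_vec E (Poly_Mapping.keys m)"
  have ml: "\<And>m' i. m' \<in> Poly_Mapping.keys p \<Longrightarrow> Poly_Mapping.lookup m' i \<le> 1"
    and vars: "\<And>m'. m' \<in> Poly_Mapping.keys p \<Longrightarrow> Poly_Mapping.keys m' \<subseteq> E"
    using assms by (auto simp: is_nnf_def multilinear_def poly_vars_def)
  have ev: "poly_eval p (\<lambda>i. lift_bit (?x i)) = 0"
    using assms char_vec_in_F2 unfolding is_nnf_def by blast
  have val: "(\<Prod>i\<in>Poly_Mapping.keys m'. lift_bit (?x i) ^ Poly_Mapping.lookup m' i) =
      (if m' = m then 1 else (0::real))" if m': "m' \<in> Poly_Mapping.keys p" for m'
  proof (cases "m' = m")
    case True
    then show ?thesis using vars[OF m]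
      by (auto intro!: prod.neutral simp: char_vec_def lift_bit_def)
  next
    case False
    have "\<not> Poly_Mapping.keys m' \<subseteq> Poly_Mapping.keys m"
    proof
      assume "Poly_Mapping.keys m' \<subseteq> Poly_Mapping.keys m"
      then have eq: "Poly_Mapping.keys m' = Poly_Mapping.keys m"
        using min[OF m'] by (simp add: card_subset_eq card_mono le_antisym)
      have "Poly_Mapping.lookup m' i = Poly_Mapping.lookup m i" for i
      proof -
        have "Poly_Mapping.lookup m' i = 0 \<longleftrightarrow> Poly_Mapping.lookup m i = 0"
          using eq by (metis in_keys_iff)
        then show ?thesis using ml[OF m', of i] ml[OF m, of i] by linarith
      qed
      then show False using False by (simp add: poly_mapping_eqI)
    qed
    then obtain i where i: "i \<in> Poly_Mapping.keys m'" "i \<notin> Poly_Mapping.keys m" by blast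
    moreover have "i \<in> E" using i vars[OF m'] by blast
    ultimately have "(lift_bit (?x i) :: real) ^ Poly_Mapping.lookup m' i = 0"
      by (auto simp: char_vec_def lift_bit_def in_keys_iff)
    then show ?thesis using i False by (simp add: prod_zero_iff) blast
  qed
  have "poly_eval p (\<lambda>i. lift_bit (?x i)) =
      (\<Sum>m'\<in>Poly_Mapping.keys p. if m' = m then Poly_Mapping.lookup p m' else 0)"
    unfolding poly_eval_def by (rule sum.cong) (auto simp: val)
  also have "\<dots> = Poly_Mapping.lookup p m" using m by simp
  finally show False using ev m by (simp add: in_keys_iff)
qed

lemma nnf_unique:
  assumes "is_nnf E g p" "is_nnf E g q"
  shows "p = q"
proof -
  have sub: "Poly_Mapping.keys (p - q) \<subseteq> Poly_Mapping.keys p \<union> Poly_Mapping.keys q"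
    by (rule keys_diff)
  have "is_nnf E (\<lambda>_. 0) (p - q)"
    unfolding is_nnf_def
  proof (intro conjI ballI)
    show "multilinear (p - q)"
      unfolding multilinear_def
    proof (intro ballI allI)
      fix m i assume "m \<in> Poly_Mapping.keys (p - q)"
      then have "m \<in> Poly_Mapping.keys p \<or> m \<in> Poly_Mapping.keys q" using sub by blast
      then show "Poly_Mapping.lookup m i \<le> 1"
        using assms unfolding is_nnf_def multilinear_def by blast
    qed
    have "poly_vars (p - q) \<subseteq> poly_vars p \<union> poly_vars q"
      using sub unfolding poly_vars_def by blast
    then show "poly_vars (p - q) \<subseteq> E"
      using assms unfolding is_nnf_def by blast
    show "poly_eval (p - q) (\<lambda>i. lift_bit (x i)) = 0" if "x \<in> F2 E" for x
      using assms that by (simp add: poly_eval_diff is_nnf_def)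
  qed
  then have "p - q = 0" by (rule nnf_zero)
  then show ?thesis by (simp only: right_minus_eq)
qed

definition sqfree_monom :: "'e set \<Rightarrow> 'e \<Rightarrow>\<^sub>0 nat" where
  "sqfree_monom S = (\<Sum>i\<in>S. Poly_Mapping.single i 1)"

lemma lookup_sqfree_monom:
  "finite S \<Longrightarrow> Poly_Mapping.lookup (sqfree_monom S) i = (if i \<in> S then 1 else 0)"
  by (simp add: sqfree_monom_def lookup_sum lookup_single when_def)

lemma keys_sqfree_monom: "finite S \<Longrightarrow> Poly_Mapping.keys (sqfree_monom S) = S"
  by (auto simp: in_keys_iff lookup_sqfree_monom split: if_splits)

lemma nnf_exists:
  fixes g :: "('e \<Rightarrow> bit) \<Rightarrow> real"
  assumes "finite E"
  shows "\<exists>p. is_nnf E g p"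
proof -
  define h where "h S = g (char_vec E S)" for S
  define k where "k S = (\<Sum>T\<in>Pow S. (-1) ^ card T * h T)" for S
  define c where "c S = (-1) ^ card S * k S" for S
  have mobius: "h S = (\<Sum>T\<in>Pow S. c T)" if "finite S" for S
    using inclusion_exclusion_symmetric[of k h S] that by (simp add: k_def c_def)
  define p where "p = (\<Sum>S\<in>Pow E. Poly_Mapping.single (sqfree_monom S) (c S))"
  have fin: "finite S" if "S \<in> Pow E" for S using that assms finite_subset by auto
  have inj: "inj_on sqfree_monom (Pow E)"
    by (rule inj_onI) (metis fin keys_sqfree_monom)
  have keys: "Poly_Mapping.keys p \<subseteq> sqfree_monom ` Pow E"
  proof -
    have "Poly_Mapping.keys p \<subseteq>
        (\<Union>S\<in>Pow E. Poly_Mapping.keys (Poly_Mapping.single (sqfree_monom S) (c S)))"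
      unfolding p_def by (rule keys_sum)
    also have "\<dots> \<subseteq> sqfree_monom ` Pow E" by (auto split: if_splits)
    finally show ?thesis .
  qed
  have lookup: "Poly_Mapping.lookup p (sqfree_monom S) = c S" if S: "S \<in> Pow E" for S
  proof -
    have "Poly_Mapping.lookup p (sqfree_monom S) = (\<Sum>T\<in>Pow E. if T = S then c T else 0)"
      unfolding p_def lookup_sum
      by (rule sum.cong) (use inj S in \<open>auto simp: lookup_single when_def inj_on_eq_iff\<close>)
    then show ?thesis using S assms by simp
  qed
  have "poly_eval p (\<lambda>i. lift_bit (x i)) = g x" if x: "x \<in> F2 E" for x
  proof -
    define A where "A = {i \<in> E. x i = 1}"
    have prod: "(\<Prod>i\<in>S. lift_bit (x i)) = (if S \<in> Pow A then 1 else (0::real))"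
      if S: "S \<in> Pow E" for S
    proof (cases "S \<subseteq> A")
      case True
      then show ?thesis by (auto intro!: prod.neutral simp: A_def lift_bit_def)
    next
      case False
      then obtain i where "i \<in> S" "i \<notin> A" by blast
      then have "i \<in> S \<and> x i \<noteq> 1" using S by (auto simp: A_def)
      then have "\<exists>i\<in>S. (lift_bit (x i) :: real) = 0" by (auto simp: lift_bit_def)
      then have "(\<Prod>i\<in>S. lift_bit (x i)) = (0::real)"
        using fin[OF S] by (simp add: prod_zero_iff)
      then show ?thesis using False by simp
    qed
    have "poly_eval p (\<lambda>i. lift_bit (x i)) =
        (\<Sum>S\<in>Pow E. c S * (\<Prod>i\<in>S. lift_bit (x i) ^ Poly_Mapping.lookup (sqfree_monom S) i))"
      using keys assms
      by (subst poly_eval_superset[of "sqfree_monom ` Pow E"])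
        (auto simp: sum.reindex[OF inj] lookup keys_sqfree_monom fin intro!: sum.cong)
    also have "\<dots> = (\<Sum>S\<in>Pow E. c S * (\<Prod>i\<in>S. lift_bit (x i)))"
      by (intro sum.cong arg_cong2[where f = "(*)"] prod.cong)
        (auto simp: lookup_sqfree_monom fin)
    also have "\<dots> = (\<Sum>S\<in>Pow E. if S \<in> Pow A then c S else 0)"
      by (intro sum.cong) (simp_all only: prod, auto)
    also have "\<dots> = (\<Sum>S\<in>Pow E \<inter> Pow A. c S)"
      using assms by (simp add: sum.inter_restrict)
    also have "Pow E \<inter> Pow A = Pow A" by (auto simp: A_def)
    also have "(\<Sum>S\<in>Pow A. c S) = h A"
      using mobius[of A] assms by (simp add: A_def)
    also have "char_vec E A = x"
      using x by (auto simp: char_vec_def A_def F2_def fun_eq_iff PiE_def extensional_def)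
    then have "h A = g x" by (simp add: h_def)
    finally show ?thesis .
  qed
  moreover have "Poly_Mapping.keys m \<subseteq> E \<and> (\<forall>i. Poly_Mapping.lookup m i \<le> 1)"
    if m: "m \<in> Poly_Mapping.keys p" for m
  proof -
    obtain S where "S \<in> Pow E" "m = sqfree_monom S" using keys m by blast
    then show ?thesis using fin by (simp add: keys_sqfree_monom lookup_sqfree_monom)
  qed
  then have "multilinear p" "poly_vars p \<subseteq> E"
    by (auto simp: multilinear_def poly_vars_def)
  ultimately show ?thesis by (auto simp: is_nnf_def)
qed

lemma ex1_nnf: "finite E \<Longrightarrow> \<exists>!p. is_nnf E g p"
  using nnf_exists nnf_unique by blast

lemma is_nnf_nnf: "finite E \<Longrightarrow> is_nnf E g (nnf E g)"
  unfolding nnf_def by (rule theI') (rule ex1_nnf)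

lemma poly_eval_FH:
  assumes "finite (edges G)" "x \<in> F2 (edges G)"
  shows "poly_eval (FH G) (\<lambda>i. lift_bit (x i)) =
    of_int (fourier_hadamard (edges G) (tree_function G) x)"
  using is_nnf_nnf[OF assms(1)] assms(2) by (auto simp: FH_def is_nnf_def)

end

theory Submission
  imports Defs
begin

text \<open>The spanning trees of \<open>G\<close> avoiding \<open>e\<close> are those of \<open>G \ e\<close>, and \<open>T \<mapsto> T \<union> {e}\<close> maps those of
  \<open>G / e\<close> bijectively to the ones containing \<open>e\<close>, where the summand picks up the factor
  \<open>(-1)^x\<^sub>e = 1 - 2 x\<^sub>e\<close>. For the bijection, a connected graph is a tree iff no edge has ends that are
  connected by the remaining edges, and vertices are connected by \<open>T\<close> in \<open>G / e\<close> iff they are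
  connected by \<open>T \<union> {e}\<close> in \<open>G\<close>. Since \<open>e\<close> is not a variable of \<open>FH (G / e)\<close>, the right-hand side is
  multilinear, hence a Numerical Normal Form, which is unique.\<close>

section \<open>Connectivity and cycles\<close>

text \<open>The edge set is a parameter separate from \<open>G\<close>, so that it can vary while
  vertices and ends stay fixed. Unlike \<open>reachable\<close>, the relation is not restricted to
  \<open>verts G\<close>, so no membership has to be carried along walks.\<close>

definition edge_conn :: "('v, 'e) mgraph \<Rightarrow> 'e set \<Rightarrow> ('v \<times> 'v) set" where
  "edge_conn G S = (adj (G\<lparr>edges := S\<rparr>))\<^sup>*"

lemma adj_edges_iff: "(u, v) \<in> adj (G\<lparr>edges := S\<rparr>) \<longleftrightarrow> (\<exists>f\<in>S. ends G f = Upair u v)"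
  by (simp add: adj_def)

lemma edge_conn_refl: "(u, u) \<in> edge_conn G S"
  by (simp add: edge_conn_def)

lemma edge_conn_edge: "f \<in> S \<Longrightarrow> ends G f = Upair u v \<Longrightarrow> (u, v) \<in> edge_conn G S"
  unfolding edge_conn_def by (rule r_into_rtrancl) (auto simp: adj_edges_iff)

lemma edge_conn_trans:
  "(u, v) \<in> edge_conn G S \<Longrightarrow> (v, w) \<in> edge_conn G S \<Longrightarrow> (u, w) \<in> edge_conn G S"
  unfolding edge_conn_def by (rule rtrancl_trans)

lemma edge_conn_sym:
  assumes "(u, v) \<in> edge_conn G S"
  shows "(v, u) \<in> edge_conn G S"
proof -
  have "sym (adj (G\<lparr>edges := S\<rparr>))"
    by (rule symI) (metis adj_edges_iff Upair_inject)
  then show ?thesis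
    using assms unfolding edge_conn_def by (metis sym_rtrancl symD)
qed

lemma edge_conn_mono:
  assumes "(u, v) \<in> edge_conn G S" "S \<subseteq> S'"
  shows "(u, v) \<in> edge_conn G S'"
proof -
  have "adj (G\<lparr>edges := S\<rparr>) \<subseteq> adj (G\<lparr>edges := S'\<rparr>)"
    using assms(2) by (auto simp: adj_def)
  then show ?thesis
    using assms(1) rtrancl_mono unfolding edge_conn_def by blast
qed

lemma edge_conn_insert_cases:
  assumes "(u, v) \<in> edge_conn G (insert f S)" and f: "ends G f = Upair c d"
  shows "(u, v) \<in> edge_conn G S \<or>
    (u, c) \<in> edge_conn G S \<and> (d, v) \<in> edge_conn G S \<or>
    (u, d) \<in> edge_conn G S \<and> (c, v) \<in> edge_conn G S"
  using assms(1) unfolding edge_conn_def[of _ "insert f S"]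
proof (induction rule: rtrancl_induct)
  case base
  then show ?case by (simp add: edge_conn_refl)
next
  case (step y z)
  from step.hyps(2) obtain g where g: "g \<in> insert f S" "ends G g = Upair y z"
    by (auto simp: adj_edges_iff)
  show ?case
  proof (cases "g \<in> S")
    case True
    then have "(y, z) \<in> edge_conn G S" using g edge_conn_edge by metis
    then show ?thesis using step.IH edge_conn_trans by metis
  next
    case False
    then have "y = c \<and> z = d \<or> y = d \<and> z = c"
      using g f by (auto simp: Upair_inject)
    then show ?thesis using step.IH edge_conn_refl by metis
  qed
qed

text \<open>Without its first edge, a cycle is still a walk from its second vertex around to
  \<open>vs ! 0\<close>.\<close>

lemma is_cycle_edge_conn:
  assumes "is_cycle (G\<lparr>edges := T\<rparr>) vs es"
  shows "\<exists>f\<in>T. \<exists>u v. ends G f = Upair u v \<and> (u, v) \<in> edge_conn G (T - {f})"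
proof -
  let ?n = "length es"
  have n: "?n > 0" and dist: "distinct es" and sub: "set es \<subseteq> T"
    and ed: "\<And>i. i < ?n \<Longrightarrow> ends G (es ! i) = Upair (vs ! i) (vs ! (Suc i mod ?n))"
    using assms by (auto simp: is_cycle_def)
  let ?S = "T - {es ! 0}"
  \<comment> \<open>Writing \<open>1 mod ?n\<close> covers the cycle of length 1, where the
    remaining walk is empty. The case \<open>i = ?n - 1\<close> wraps round to
    \<open>vs ! 0\<close>.\<close>
  have "(vs ! (1 mod ?n), vs ! (Suc i mod ?n)) \<in> edge_conn G ?S" if "i < ?n" for i
    using that
  proof (induction i)
    case 0
    then show ?case by (simp add: edge_conn_refl)
  next
    case (Suc i)
    then have "es ! Suc i \<in> ?S" using dist sub n by (auto simp: nth_eq_iff_index_eq)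
    then have "(vs ! Suc i, vs ! (Suc (Suc i) mod ?n)) \<in> edge_conn G ?S"
      using ed[OF Suc.prems] edge_conn_edge by metis
    moreover have "Suc i mod ?n = Suc i" using Suc.prems by simp
    ultimately show ?case using Suc edge_conn_trans by (metis Suc_lessD)
  qed
  from this[of "?n - 1"] have "(vs ! (1 mod ?n), vs ! 0) \<in> edge_conn G ?S" using n by simp
  then have "(vs ! 0, vs ! (1 mod ?n)) \<in> edge_conn G ?S" by (rule edge_conn_sym)
  moreover have "es ! 0 \<in> T" using n sub by auto
  moreover have "ends G (es ! 0) = Upair (vs ! 0) (vs ! (1 mod ?n))" using ed[of 0] n by simp
  ultimately show ?thesis by blast
qed

text \<open>A shortest walk between the ends of \<open>f\<close> avoiding \<open>f\<close> is a path, which \<open>f\<close> closes to a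
  cycle.\<close>

lemma edge_conn_is_cycle:
  assumes "f \<in> T" and f: "ends G f = Upair u v" and conn: "(u, v) \<in> edge_conn G (T - {f})"
  shows "\<exists>vs es. is_cycle (G\<lparr>edges := T\<rparr>) vs es"
proof -
  define R where "R = adj (G\<lparr>edges := T - {f}\<rparr>)"
  have "\<exists>n. (u, v) \<in> R ^^ n" using conn by (auto simp: edge_conn_def R_def rtrancl_power)
  define n where "n = (LEAST n. (u, v) \<in> R ^^ n)"
  have n: "(u, v) \<in> R ^^ n" unfolding n_def by (rule LeastI_ex) fact
  have least: "n \<le> m" if "(u, v) \<in> R ^^ m" for m
    unfolding n_def using that by (rule Least_le)
  obtain w where w: "w 0 = u" "w n = v" "\<And>i. i < n \<Longrightarrow> (w i, w (Suc i)) \<in> R"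
    using n by (auto simp: relpow_fun_conv)
  have walk: "(w i, w (i + k)) \<in> R ^^ k" if "i + k \<le> n" for i k
    unfolding relpow_fun_conv
    by (rule exI[of _ "\<lambda>j. w (i + j)"]) (use w(3) that in auto)
  \<comment> \<open>Otherwise dropping the stretch from \<open>i\<close> to \<open>j\<close> would
    give a shorter walk from \<open>u\<close> to \<open>v\<close>.\<close>
  have noteq: "w i \<noteq> w j" if "i < j" "j \<le> n" for i j
  proof
    assume eq: "w i = w j"
    have "(u, w i) \<in> R ^^ i" using walk[of 0 i] that w(1) by simp
    moreover have "(w i, v) \<in> R ^^ (n - j)" using walk[of j "n - j"] that w(2) eq by simp
    ultimately have "(u, v) \<in> R ^^ (i + (n - j))" by (auto simp: relpow_add)
    from least[OF this] show False using that by linarith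
  qed
  have w_inj: "i = j" if "w i = w j" "i \<le> n" "j \<le> n" for i j
    using noteq[of i j] noteq[of j i] that by (metis linorder_neqE_nat)
  have "\<forall>i. \<exists>g. i < n \<longrightarrow> g \<in> T - {f} \<and> ends G g = Upair (w i) (w (Suc i))"
    using w(3) unfolding R_def adj_edges_iff by blast
  then obtain h where h: "\<And>i. i < n \<Longrightarrow> h i \<in> T - {f}"
    "\<And>i. i < n \<Longrightarrow> ends G (h i) = Upair (w i) (w (Suc i))"
    by metis
  have h_inj: "inj_on h {0..<n}"
  proof (rule inj_onI)
    fix i j assume ij: "i \<in> {0..<n}" "j \<in> {0..<n}" "h i = h j"
    then have "Upair (w i) (w (Suc i)) = Upair (w j) (w (Suc j))"
      using h(2) by (metis atLeastLessThan_iff)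
    \<comment> \<open>Equal edges have equal ends, in the same or in reversed order. Since the
      vertices of the walk are distinct, the reversed order would force \<open>i = Suc j\<close> and
      \<open>Suc i = j\<close> at once.\<close>
    then have "w i = w j \<or> w i = w (Suc j) \<and> w (Suc i) = w j" by (auto simp: Upair_inject)
    then have "i = j \<or> i = Suc j \<and> Suc i = j" using w_inj ij by auto
    then show "i = j" by auto
  qed
  \<comment> \<open>The edge \<open>f\<close> leads from \<open>w n = v\<close> back to
    \<open>w 0 = u\<close>. If \<open>f\<close> is a loop, then \<open>n = 0\<close> and the cycle
    consists of \<open>f\<close> alone.\<close>
  let ?vs = "map w [0..<Suc n]" and ?es = "map h [0..<n] @ [f]"
  have "is_cycle (G\<lparr>edges := T\<rparr>) ?vs ?es"
    unfolding is_cycle_def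
  proof (intro conjI allI impI)
    show "distinct ?vs"
      by (auto simp: distinct_map simp del: upt_Suc intro!: inj_onI w_inj)
    show "distinct ?es" using h_inj h(1) by (fastforce simp: distinct_map)
    show "set ?es \<subseteq> edges (G\<lparr>edges := T\<rparr>)" using h(1) assms(1) by auto
    fix i assume i: "i < length ?es"
    show "ends (G\<lparr>edges := T\<rparr>) (?es ! i) = Upair (?vs ! i) (?vs ! (Suc i mod length ?es))"
    proof (cases "i < n")
      case True
      then have "?vs ! (Suc i mod length ?es) = w (Suc i)" "?vs ! i = w i"
        by (simp_all add: nth_append del: upt_Suc)
      then show ?thesis using True h(2) by (simp add: nth_append)
    next
      case False
      then have "i = n" using i by simp
      then have "?vs ! (Suc i mod length ?es) = w 0" "?vs ! i = w n" "?es ! i = f"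
        by (simp_all add: nth_append del: upt_Suc)
      then show ?thesis using f w by (simp add: Upair_inject)
    qed
  qed auto
  then show ?thesis by blast
qed

text \<open>Acyclicity becomes a condition on \<open>edge_conn\<close> alone: every edge of
  \<open>T\<close> is a bridge of \<open>T\<close>. Unlike cycles given by lists, this carries over
  to the contraction directly.\<close>

lemma is_tree_iff:
  "is_tree (G\<lparr>edges := T\<rparr>) \<longleftrightarrow>
    verts G \<noteq> {} \<and> (\<forall>u\<in>verts G. \<forall>v\<in>verts G. (u, v) \<in> edge_conn G T) \<and>
    (\<forall>f\<in>T. \<forall>u v. ends G f = Upair u v \<longrightarrow> (u, v) \<notin> edge_conn G (T - {f}))"
proof -
  have "(\<exists>vs es. is_cycle (G\<lparr>edges := T\<rparr>) vs es) \<longleftrightarrow>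
      (\<exists>f\<in>T. \<exists>u v. ends G f = Upair u v \<and> (u, v) \<in> edge_conn G (T - {f}))"
    using is_cycle_edge_conn edge_conn_is_cycle by metis
  then show ?thesis
    unfolding is_tree_def connected_graph_def reachable_def edge_conn_def by auto
qed

section \<open>Spanning trees under deletion and contraction\<close>

lemma merge_ends_eq_edge_conn:
  assumes "merge_ends G e x = merge_ends G e y" "e \<in> S"
  shows "(x, y) \<in> edge_conn G S"
proof -
  obtain a b where e: "ends G e = Upair a b" by (rule uprod_exhaust)
  have ab: "(a, b) \<in> edge_conn G S" using e assms(2) by (rule edge_conn_edge[rotated])
  have "x = y \<or> x = a \<and> y = b \<or> x = b \<and> y = a"
    using assms(1) by (auto simp: merge_ends_def e split: if_splits)
  then show ?thesis using ab edge_conn_refl edge_conn_sym by metis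
qed

lemma adj_contract_edge:
  "(A, B) \<in> adj ((contract_edge G e)\<lparr>edges := T\<rparr>) \<longleftrightarrow>
    (\<exists>a b. A = merge_ends G e a \<and> B = merge_ends G e b \<and> (a, b) \<in> adj (G\<lparr>edges := T\<rparr>))"
  (is "?L \<longleftrightarrow> ?R")
proof
  assume ?L
  then obtain f where f: "f \<in> T" "map_uprod (merge_ends G e) (ends G f) = Upair A B"
    unfolding adj_edges_iff by (auto simp: contract_edge_def)
  obtain u v where uv: "ends G f = Upair u v" by (rule uprod_exhaust)
  then have "A = merge_ends G e u \<and> B = merge_ends G e v \<or>
      A = merge_ends G e v \<and> B = merge_ends G e u"
    using f(2) by (auto simp: Upair_inject)
  moreover have "(u, v) \<in> adj (G\<lparr>edges := T\<rparr>)" "(v, u) \<in> adj (G\<lparr>edges := T\<rparr>)"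
    using f(1) uv unfolding adj_edges_iff by (metis Upair_inject)+
  ultimately show ?R by blast
next
  assume ?R
  then obtain a b f where "A = merge_ends G e a" "B = merge_ends G e b" "f \<in> T"
    "ends G f = Upair a b"
    by (auto simp: adj_edges_iff)
  then have "f \<in> T" "map_uprod (merge_ends G e) (ends G f) = Upair A B" by simp_all
  then show ?L unfolding adj_edges_iff by (auto simp: contract_edge_def)
qed

text \<open>A walk in the contraction lifts edge by edge; where consecutive lifts do not meet, they
  stop and start at the two ends of \<open>e\<close>, which \<open>e\<close> joins. Conversely, the
  image of a walk is a walk from which crossings of \<open>e\<close> can be left out.\<close>

lemma edge_conn_contract_edge:
  "(merge_ends G e x, merge_ends G e y) \<in> edge_conn (contract_edge G e) T \<longleftrightarrow>
    (x, y) \<in> edge_conn G (insert e T)"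
proof
  have "(x, y) \<in> edge_conn G (insert e T)"
    if "(A, B) \<in> edge_conn (contract_edge G e) T" "A = merge_ends G e x" "B = merge_ends G e y"
    for A B x y
    using that unfolding edge_conn_def[of "contract_edge G e"]
  \<comment> \<open>The induction hypothesis is needed at \<open>b\<close>, where the lifted last
    edge starts, so it has to hold for every representative of \<open>B\<close>.\<close>
  proof (induction arbitrary: y rule: rtrancl_induct)
    case base
    then show ?case by (metis insertI1 merge_ends_eq_edge_conn)
  next
    case (step B C)
    then obtain b c where bc: "B = merge_ends G e b" "C = merge_ends G e c"
      "(b, c) \<in> adj (G\<lparr>edges := T\<rparr>)"
      by (auto simp: adj_contract_edge)
    then have "(b, c) \<in> edge_conn G (insert e T)"
      by (auto simp: adj_edges_iff intro: edge_conn_edge)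
    moreover have "(c, y) \<in> edge_conn G (insert e T)"
      using bc(2) step.prems(2) by (metis insertI1 merge_ends_eq_edge_conn)
    ultimately show ?case using step.IH[OF step.prems(1) bc(1)] edge_conn_trans by metis
  qed
  then show "(merge_ends G e x, merge_ends G e y) \<in> edge_conn (contract_edge G e) T \<Longrightarrow>
    (x, y) \<in> edge_conn G (insert e T)" by blast
next
  assume "(x, y) \<in> edge_conn G (insert e T)"
  then show "(merge_ends G e x, merge_ends G e y) \<in> edge_conn (contract_edge G e) T"
    unfolding edge_conn_def[of G]
  proof (induction rule: rtrancl_induct)
    case base
    show ?case by (rule edge_conn_refl)
  next
    case (step y z)
    then obtain f where f: "f \<in> insert e T" "ends G f = Upair y z" by (auto simp: adj_edges_iff)
    have "(merge_ends G e y, merge_ends G e z) \<in> edge_conn (contract_edge G e) T"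
    proof (cases "f \<in> T")
      case True
      then show ?thesis
        by (rule edge_conn_edge) (simp add: contract_edge_def f)
    next
      case False
      then have "merge_ends G e y = merge_ends G e z" using f by (simp add: merge_ends_def)
      then show ?thesis by (simp add: edge_conn_refl)
    qed
    then show ?case using step.IH edge_conn_trans by metis
  qed
qed

text \<open>Take a minimal set of edges connecting \<open>a\<close> and \<open>b\<close>: each of its edges separates it into a
  part connected to \<open>a\<close> and a part connected to \<open>b\<close>.\<close>

lemma edge_conn_exchange:
  assumes "finite T" "(a, b) \<in> edge_conn G T" "a \<noteq> b" "ends G e = Upair a b"
  shows "\<exists>f\<in>T. \<exists>c d. ends G f = Upair c d \<and> (c, d) \<in> edge_conn G (insert e (T - {f}))"
  using assms(1,2)
proof (induction rule: finite_psubset_induct)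
  case (psubset T)
  have "T \<noteq> {}"
  proof
    assume "T = {}"
    then have "adj (G\<lparr>edges := T\<rparr>) = {}" by (simp add: adj_def)
    then show False using psubset.prems assms(3) by (simp add: edge_conn_def)
  qed
  then obtain f where f: "f \<in> T" by blast
  obtain c d where cd: "ends G f = Upair c d" by (rule uprod_exhaust)
  show ?case
  proof (cases "(a, b) \<in> edge_conn G (T - {f})")
    case True
    have "T - {f} \<subset> T" using f by blast
    from psubset.IH[OF this True] obtain g c d where "g \<in> T" "ends G g = Upair c d"
      "(c, d) \<in> edge_conn G (insert e (T - {f} - {g}))" by blast
    moreover have "insert e (T - {f} - {g}) \<subseteq> insert e (T - {g})" by blast
    ultimately show ?thesis using edge_conn_mono by metis
  next
    case False
    have "(a, b) \<in> edge_conn G (insert f (T - {f}))"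
      using psubset.prems f by (simp add: insert_absorb)
    from edge_conn_insert_cases[OF this cd] False
    have "(a, c) \<in> edge_conn G (T - {f}) \<and> (d, b) \<in> edge_conn G (T - {f}) \<or>
      (a, d) \<in> edge_conn G (T - {f}) \<and> (c, b) \<in> edge_conn G (T - {f})"
      by blast
    then have "(a, c) \<in> edge_conn G (insert e (T - {f})) \<and>
        (d, b) \<in> edge_conn G (insert e (T - {f})) \<or>
      (a, d) \<in> edge_conn G (insert e (T - {f})) \<and> (c, b) \<in> edge_conn G (insert e (T - {f}))"
      using edge_conn_mono[OF _ subset_insertI] by metis
    \<comment> \<open>The set \<open>T - {f}\<close> joins one end of \<open>f\<close> to
      \<open>a\<close> and the other to \<open>b\<close>; adding \<open>e\<close> completes a walk
      between the ends of \<open>f\<close>.\<close>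
    moreover have "(a, b) \<in> edge_conn G (insert e (T - {f}))"
      using assms(4) by (rule edge_conn_edge[OF insertI1])
    ultimately have "(c, d) \<in> edge_conn G (insert e (T - {f}))"
      using edge_conn_sym edge_conn_trans by metis
    then show ?thesis using f cd by blast
  qed
qed

text \<open>Connectivity and the bridge condition for the edges of \<open>T\<close> transfer by
  \<open>edge_conn_contract_edge\<close>. The only condition on the right without a counterpart on
  the left is that \<open>e\<close> is a bridge; it follows from the others, whereas for a loop
  \<open>e\<close> it would always fail.\<close>

lemma is_tree_contract_edge:
  assumes "finite T" "e \<notin> T" "\<not> is_loop G e"
  shows "is_tree ((contract_edge G e)\<lparr>edges := T\<rparr>) \<longleftrightarrow> is_tree (G\<lparr>edges := insert e T\<rparr>)"
proof -
  let ?H = "contract_edge G e" and ?m = "merge_ends G e"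
  have verts: "verts ?H = ?m ` verts G" by (simp add: contract_edge_def)
  have contract_bridge: "(\<forall>u v. ends ?H f = Upair u v \<longrightarrow> (u, v) \<notin> edge_conn ?H (T - {f})) \<longleftrightarrow>
      (\<forall>u v. ends G f = Upair u v \<longrightarrow> (u, v) \<notin> edge_conn G (insert e (T - {f})))" for f
  proof -
    obtain c d where cd: "ends G f = Upair c d" by (rule uprod_exhaust)
    have fH: "ends ?H f = Upair (?m c) (?m d)" by (simp add: contract_edge_def cd)
    \<comment> \<open>An unordered pair fixes \<open>u\<close> and \<open>v\<close> up to order, and
      \<open>edge_conn\<close> is symmetric, so one orientation suffices.\<close>
    have "(\<forall>u v. ends ?H f = Upair u v \<longrightarrow> (u, v) \<notin> edge_conn ?H (T - {f})) \<longleftrightarrow>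
        (?m c, ?m d) \<notin> edge_conn ?H (T - {f})"
      unfolding fH by (metis Upair_inject edge_conn_sym)
    also have "\<dots> \<longleftrightarrow> (c, d) \<notin> edge_conn G (insert e (T - {f}))"
      by (simp add: edge_conn_contract_edge)
    also have "\<dots> \<longleftrightarrow>
        (\<forall>u v. ends G f = Upair u v \<longrightarrow> (u, v) \<notin> edge_conn G (insert e (T - {f})))"
      unfolding cd by (metis Upair_inject edge_conn_sym)
    finally show ?thesis .
  qed
  have rest: "insert e T - {f} = insert e (T - {f})" if "f \<in> T" for f
    using that assms(2) by auto
  \<comment> \<open>If \<open>T\<close> joined the ends of \<open>e\<close>, then
    \<open>edge_conn_exchange\<close> would give an edge of \<open>T\<close> that is not a bridge of
    \<open>insert e T\<close>. It needs distinct ends, which is where \<open>e\<close> not being a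
    loop enters.\<close>
  have "(u, v) \<notin> edge_conn G (insert e T - {e})"
    if "\<forall>f\<in>T. \<forall>u v. ends G f = Upair u v \<longrightarrow> (u, v) \<notin> edge_conn G (insert e (T - {f}))"
      "ends G e = Upair u v" for u v
  proof
    assume "(u, v) \<in> edge_conn G (insert e T - {e})"
    then have "(u, v) \<in> edge_conn G T" using assms(2) by simp
    moreover have "u \<noteq> v" using that(2) assms(3) by (auto simp: is_loop_def)
    ultimately show False using edge_conn_exchange[OF assms(1)] that by metis
  qed
  then show ?thesis
    unfolding is_tree_iff verts by (auto simp: edge_conn_contract_edge contract_bridge rest)
qed

lemma spanning_trees_delete_contract:
  assumes "finite (edges G)" "e \<in> edges G" "\<not> is_loop G e"
  shows "spanning_trees G =
    spanning_trees (delete_edge G e) \<union> insert e ` spanning_trees (contract_edge G e)"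
proof -
  have "T \<in> spanning_trees (delete_edge G e) \<longleftrightarrow> T \<in> spanning_trees G \<and> e \<notin> T" for T
    by (auto simp: spanning_trees_def delete_edge_def)
  moreover have contract: "T \<in> spanning_trees (contract_edge G e) \<longleftrightarrow>
      e \<notin> T \<and> insert e T \<in> spanning_trees G" for T
  \<comment> \<open>If \<open>T\<close> is not contained in \<open>edges G - {e}\<close>, both sides
    fail by containment alone.\<close>
  proof (cases "T \<subseteq> edges G - {e}")
    case True
    then have "finite T" "e \<notin> T" using assms(1) finite_subset by auto
    from is_tree_contract_edge[OF this assms(3)] True assms(2) show ?thesis
      by (auto simp: spanning_trees_def) (auto simp: contract_edge_def)
  next
    case False
    then show ?thesis by (auto simp: spanning_trees_def contract_edge_def)
  qed
  moreover have "T \<in> insert e ` spanning_trees (contract_edge G e) \<longleftrightarrow>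
      T \<in> spanning_trees G \<and> e \<in> T" for T
  proof
    assume "T \<in> spanning_trees G \<and> e \<in> T"
    then have "T = insert e (T - {e})" "T - {e} \<in> spanning_trees (contract_edge G e)"
      by (auto simp: contract insert_absorb)
    then show "T \<in> insert e ` spanning_trees (contract_edge G e)" by blast
  qed (auto simp: contract)
  ultimately show ?thesis by blast
qed

section \<open>The Fourier-Hadamard transform under deletion and contraction\<close>

lemma dot_char_vec:
  assumes "finite E" "T \<subseteq> E"
  shows "dot E (char_vec E T) x = sum x T"
proof -
  have "dot E (char_vec E T) x = (\<Sum>i\<in>E. if i \<in> T then x i else 0)"
    unfolding dot_def by (rule sum.cong) (auto simp: char_vec_def)
  then show ?thesis
    using assms by (simp add: sum.inter_restrict[symmetric] Int_absorb1)
qed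

text \<open>The exponent \<open>sum x T\<close> no longer mentions the ambient edge set, so
  \<open>G\<close>, the deletion and the contraction share the same summands, and \<open>x\<close>
  may keep its entry at \<open>e\<close> in all three transforms.\<close>

lemma fourier_hadamard_tree_function_sum:
  assumes "finite (edges G)"
  shows "fourier_hadamard (edges G) (tree_function G) x =
    (\<Sum>T\<in>spanning_trees G. (-1) ^ lift_bit (sum x T))"
  unfolding fourier_hadamard_tree_function[OF assms]
  by (rule sum.cong) (auto simp: dot_char_vec assms spanning_trees_def)

text \<open>Raising -1 to a bit is a character of the additive group of bits, with value
  \<open>1 - 2 * b\<close> for \<open>b\<close> read as 0 or 1. The exponents are lifted to
  naturals, the factor to an integer.\<close>

lemma sign_lift_bit_add:
  "(-1 :: int) ^ lift_bit (b + c) = (1 - 2 * lift_bit b) * (-1) ^ lift_bit c"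
  by (cases b; cases c) (simp_all add: lift_bit_def)

lemma fourier_hadamard_delete_contract:
  assumes "finite (edges G)" "e \<in> edges G" "\<not> is_loop G e"
  shows "fourier_hadamard (edges G) (tree_function G) x =
    fourier_hadamard (edges (delete_edge G e)) (tree_function (delete_edge G e)) x +
    (1 - 2 * lift_bit (x e)) *
      fourier_hadamard (edges (contract_edge G e)) (tree_function (contract_edge G e)) x"
proof -
  let ?D = "spanning_trees (delete_edge G e)" and ?C = "spanning_trees (contract_edge G e)"
  let ?s = "\<lambda>T. (-1 :: int) ^ lift_bit (sum x T)"
  have D: "e \<notin> T" if "T \<in> ?D" for T
    using that by (auto simp: spanning_trees_def delete_edge_def)
  have C: "T \<subseteq> edges G" "e \<notin> T" if "T \<in> ?C" for T
    using that by (auto simp: spanning_trees_def contract_edge_def)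
  have fin: "finite ?D" "finite ?C"
    by (rule finite_subset[of _ "Pow (edges G)"];
        use assms(1) in \<open>auto simp: spanning_trees_def delete_edge_def contract_edge_def\<close>)+
  have fin_edges: "finite (edges (delete_edge G e))" "finite (edges (contract_edge G e))"
    using assms(1) by (simp_all add: delete_edge_def contract_edge_def)
  have inj: "inj_on (insert e) ?C"
    by (rule inj_onI) (metis C(2) insert_ident)
  have disj: "?D \<inter> insert e ` ?C = {}" using D by blast
  have "(\<Sum>T\<in>spanning_trees G. ?s T) = (\<Sum>T\<in>?D. ?s T) + (\<Sum>T\<in>?C. ?s (insert e T))"
    using fin disj inj
    by (simp add: spanning_trees_delete_contract[OF assms] sum.union_disjoint sum.reindex)
  also have "(\<Sum>T\<in>?C. ?s (insert e T)) = (\<Sum>T\<in>?C. (1 - 2 * lift_bit (x e)) * ?s T)"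
  proof (rule sum.cong)
    fix T assume T: "T \<in> ?C"
    then have "finite T" using C(1) assms(1) finite_subset by blast
    then have "sum x (insert e T) = x e + sum x T" using C(2)[OF T] by simp
    then show "?s (insert e T) = (1 - 2 * lift_bit (x e)) * ?s T"
      by (simp only: sign_lift_bit_add)
  qed simp
  also have "\<dots> = (1 - 2 * lift_bit (x e)) * (\<Sum>T\<in>?C. ?s T)"
    by (simp only: sum_distrib_left)
  finally show ?thesis
    using assms(1) fin_edges by (simp only: fourier_hadamard_tree_function_sum)
qed

section \<open>Evaluation of polynomials and the Numerical Normal Form\<close>

definition monom_eval :: "('e \<Rightarrow>\<^sub>0 nat) \<Rightarrow> ('e \<Rightarrow> real) \<Rightarrow> real" where
  "monom_eval m x = (\<Prod>i\<in>Poly_Mapping.keys m. x i ^ Poly_Mapping.lookup m i)"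

lemma monom_eval_superset:
  assumes "finite A" "Poly_Mapping.keys m \<subseteq> A"
  shows "monom_eval m x = (\<Prod>i\<in>A. x i ^ Poly_Mapping.lookup m i)"
  unfolding monom_eval_def using assms
  by (intro prod.mono_neutral_left) (auto simp: in_keys_iff)

lemma monom_eval_add: "monom_eval (m + m') x = monom_eval m x * monom_eval m' x"
proof -
  let ?A = "Poly_Mapping.keys m \<union> Poly_Mapping.keys m'"
  have "Poly_Mapping.keys (m + m') \<subseteq> ?A" by (rule keys_add)
  then show ?thesis
    by (simp add: monom_eval_superset[of ?A] lookup_add power_add prod.distrib)
qed

lemma poly_eval_monom_eval:
  "poly_eval p x = (\<Sum>m\<in>Poly_Mapping.keys p. Poly_Mapping.lookup p m * monom_eval m x)"
  by (simp add: poly_eval_def monom_eval_def)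

lemma poly_eval_single: "poly_eval (Poly_Mapping.single m c) x = c * monom_eval m x"
  by (simp add: poly_eval_monom_eval)

lemma poly_eval_one: "poly_eval 1 x = 1"
  by (simp add: poly_eval_monom_eval monom_eval_def lookup_one)

lemma poly_eval_Var: "poly_eval (Var i) x = x i"
  by (simp add: Var_def poly_eval_single monom_eval_def)

lemma poly_eval_add: "poly_eval (p + q) x = poly_eval p x + poly_eval q x"
  using poly_eval_diff[of "p + q" q x] by simp

lemma poly_eval_sum: "poly_eval (\<Sum>i\<in>I. f i) x = (\<Sum>i\<in>I. poly_eval (f i) x)"
proof -
  have "poly_eval 0 x = 0" by (simp add: poly_eval_def)
  then show ?thesis
    by (induction I rule: infinite_finite_induct) (simp_all add: poly_eval_add)
qed

lemma poly_mapping_sum_single: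
  "p = (\<Sum>m\<in>Poly_Mapping.keys p. Poly_Mapping.single m (Poly_Mapping.lookup p m))"
  by (rule poly_mapping_eqI) (simp add: lookup_sum lookup_single when_def in_keys_iff)

text \<open>Both factors are expanded into monomials, which leaves only the multiplicativity in
  \<open>monom_eval_add\<close>.\<close>

lemma poly_eval_mult: "poly_eval (p * q) x = poly_eval p x * poly_eval q x"
proof -
  have "p * q = (\<Sum>m\<in>Poly_Mapping.keys p. \<Sum>m'\<in>Poly_Mapping.keys q.
      Poly_Mapping.single (m + m') (Poly_Mapping.lookup p m * Poly_Mapping.lookup q m'))"
    by (subst (1) poly_mapping_sum_single[of p], subst (1) poly_mapping_sum_single[of q])
      (simp only: sum_product mult_single)
  then have "poly_eval (p * q) x = (\<Sum>m\<in>Poly_Mapping.keys p. \<Sum>m'\<in>Poly_Mapping.keys q.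
      (Poly_Mapping.lookup p m * monom_eval m x) * (Poly_Mapping.lookup q m' * monom_eval m' x))"
    by (simp add: poly_eval_sum poly_eval_single monom_eval_add mult_ac)
  then show ?thesis by (simp only: sum_product poly_eval_monom_eval)
qed

lemma poly_eval_cong:
  assumes "\<And>i. i \<in> poly_vars p \<Longrightarrow> x i = y i"
  shows "poly_eval p x = poly_eval p y"
proof -
  have "x i = y i" if "m \<in> Poly_Mapping.keys p" "i \<in> Poly_Mapping.keys m" for m i
    using assms that unfolding poly_vars_def by blast
  then show ?thesis by (simp add: poly_eval_def)
qed

lemma FH_keys:
  assumes "finite (edges G)" "m \<in> Poly_Mapping.keys (FH G)"
  shows "Poly_Mapping.lookup m i \<le> 1" "Poly_Mapping.keys m \<subseteq> edges G"
  using is_nnf_nnf[OF assms(1)] assms(2)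
  by (auto simp: FH_def is_nnf_def multilinear_def poly_vars_def)

text \<open>A vector for \<open>G\<close> has an entry at \<open>e\<close>, so it does not satisfy
  the extensionality that \<open>poly_eval_FH\<close> demands for the deletion and the contraction.
  Both sides read only the entries at edges, so \<open>x\<close> can be restricted first; this takes
  the place of passing to the shortened vector.\<close>

lemma poly_eval_FH_nonextensional:
  assumes "finite (edges G)"
  shows "poly_eval (FH G) (\<lambda>i. lift_bit (x i)) =
    of_int (fourier_hadamard (edges G) (tree_function G) x)"
proof -
  let ?x = "restrict x (edges G)"
  have "poly_vars (FH G) \<subseteq> edges G"
    using FH_keys(2)[OF assms] by (auto simp: poly_vars_def)
  then have "poly_eval (FH G) (\<lambda>i. lift_bit (x i)) = poly_eval (FH G) (\<lambda>i. lift_bit (?x i))"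
    by (intro poly_eval_cong) auto
  also have "\<dots> = of_int (fourier_hadamard (edges G) (tree_function G) ?x)"
    by (rule poly_eval_FH[OF assms]) (unfold F2_def, rule restrict_PiE_iff[THEN iffD2], simp)
  also have "fourier_hadamard (edges G) (tree_function G) ?x =
      fourier_hadamard (edges G) (tree_function G) x"
    by (simp add: fourier_hadamard_def dot_def)
  finally show ?thesis .
qed

lemma FH_delete_contract:
  assumes fin: "finite (edges G)" and e: "e \<in> edges G" and loop: "\<not> is_loop G e"
  shows "FH G = FH (delete_edge G e) + (1 - 2 * Var e) * FH (contract_edge G e)"
proof -
  let ?E = "edges G - {e}" and ?D = "delete_edge G e" and ?C = "contract_edge G e"
  let ?l = "1 - 2 * Var e" and ?R = "FH (delete_edge G e) + (1 - 2 * Var e) * FH (contract_edge G e)"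
  have edges: "edges ?D = ?E" "edges ?C = ?E" by (simp_all add: delete_edge_def contract_edge_def)
  have fin': "finite (edges ?D)" "finite (edges ?C)" using fin by (simp_all add: edges)
  \<comment> \<open>Here \<open>0\<close> is the exponent vector of the constant monomial.\<close>
  have keys_l: "Poly_Mapping.keys ?l \<subseteq> {0, Poly_Mapping.single e 1}"
  proof -
    have "Poly_Mapping.keys (2 * Var e) \<subseteq> {Poly_Mapping.single e 1}"
      \<comment> \<open>As the sum \<open>Var e + Var e\<close>, the term has its keys bounded
        without treating the numeral as a polynomial.\<close>
      unfolding mult_2 using keys_add[of "Var e" "Var e"] by (auto simp: Var_def)
    then show ?thesis using keys_diff[of 1 "2 * Var e"] by auto
  qed
  have keys_R: "Poly_Mapping.lookup m i \<le> 1 \<and> Poly_Mapping.keys m \<subseteq> edges G"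
    if m: "m \<in> Poly_Mapping.keys ?R" for m i
  proof (cases "m \<in> Poly_Mapping.keys (FH ?D)")
    case True
    then show ?thesis using FH_keys[OF fin'(1)] by (auto simp: edges)
  next
    case False
    then have "m \<in> Poly_Mapping.keys (?l * FH ?C)"
      using m keys_add[of "FH ?D" "?l * FH ?C"] by blast
    then obtain a b where "m = a + b" "a \<in> Poly_Mapping.keys ?l"
      and b: "b \<in> Poly_Mapping.keys (FH ?C)"
      using keys_mult[of ?l "FH ?C"] by blast
    then have m: "m = b \<or> m = Poly_Mapping.single e 1 + b" using keys_l by auto
    have le: "\<And>i. Poly_Mapping.lookup b i \<le> 1" and sub: "Poly_Mapping.keys b \<subseteq> ?E"
      using FH_keys[OF fin'(2) b] by (auto simp: edges)
    \<comment> \<open>The contraction lacks the edge \<open>e\<close>, so multiplying a monomial of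
      its polynomial by \<open>Var e\<close> keeps all exponents at most 1.\<close>
    have "Poly_Mapping.lookup b e = 0" using sub by (auto simp: in_keys_iff)
    then have "Poly_Mapping.lookup m i \<le> 1"
      using m le[of i] by (auto simp: lookup_add lookup_single when_def)
    moreover have "Poly_Mapping.keys m \<subseteq> edges G"
      using m sub e keys_add[of "Poly_Mapping.single e 1" b] by auto
    ultimately show ?thesis by blast
  qed
  have "poly_eval ?R (\<lambda>i. lift_bit (x i)) =
      of_int (fourier_hadamard (edges G) (tree_function G) x)"
    for x
  proof -
    let ?x = "\<lambda>i. lift_bit (x i) :: real"
    have "poly_eval ?l ?x = 1 - 2 * ?x e"
      by (simp only: mult_2 poly_eval_diff poly_eval_one poly_eval_add poly_eval_Var)
    \<comment> \<open>The factor is real in the polynomial but an integer in the transform.\<close>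
    also have "\<dots> = of_int (1 - 2 * lift_bit (x e))"
      by (simp add: lift_bit_def)
    finally show ?thesis
      by (simp only: poly_eval_add poly_eval_mult poly_eval_FH_nonextensional fin fin' of_int_add
          of_int_mult fourier_hadamard_delete_contract[OF fin e loop, of x])
  qed
  then have "is_nnf (edges G)
      (\<lambda>u. of_int (fourier_hadamard (edges G) (tree_function G) u)) ?R"
    using keys_R unfolding is_nnf_def multilinear_def poly_vars_def by blast
  then show ?thesis
    unfolding FH_def[of G] using is_nnf_nnf[OF fin] nnf_unique by blast
qed

theorem proposition3:
  fixes G :: "('v, 'e) mgraph" and e :: 'e
  assumes "multigraph G"
    and "e \<in> edges G"
    and "\<not> is_loop G e"
    and "\<not> isthmus G e"
  shows "FH G = FH (delete_edge G e) + (1 - 2 * Var e) * FH (contract_edge G e)"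
  by (rule FH_delete_contract) (use assms in \<open>simp_all add: multigraph_def\<close>)

end
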